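(* Let $k$ and $t$ be positive integers and suppose $\mathbb{Q}^{\beth_\omega}$ is coloured with $k$ colours. Then there is an infinite set $X\subset\mathbb{Q}^{\beth_\omega}$ such that the $t$-fold sumset $\underbrace{X+X+\cdots+X}_{t}=\{x_1+x_2+\dots+x_t: x_1,\dots,x_t\in X\}$ is monochromatic.
   Context: $\beth_\omega=\sup\{\aleph_0,2^{\aleph_0},2^{2^{\aleph_0}},\dots\}$. $\mathbb{Q}^{\beth_\omega}$ denotes the rational vector space of dimension $\beth_\omega$ (the direct sum of $\beth_\omega$ copies of $\mathbb{Q}$). A $k$-colouring is an arbitrary function to a set of $k$ colours. In the $t$-fold sumset the summands need not be distinct. *)

theory Defs
  imports Main "HOL-Library.Equipollence" "HOL-Library.Function_Algebras"
begin

text \<open>A set I has cardinality beth_omega = sup of aleph_0, 2^aleph_0, 2^2^aleph_0, ...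
  iff it is the union of sets A 0, A 1, ... with |A 0| = aleph_0 and |A (n+1)| = 2^|A n|
  (so |A n| = beth_n and |I| = sup_n beth_n).\<close>
definition has_card_beth_omega :: "'i set \<Rightarrow> bool" where
  "has_card_beth_omega I \<longleftrightarrow>
     (\<exists>A :: nat \<Rightarrow> 'i set. A 0 \<approx> (UNIV :: nat set) \<and>
        (\<forall>n. A (Suc n) \<approx> Pow (A n)) \<and> I = (\<Union>n. A n))"

definition rat_vspace :: "'i set \<Rightarrow> ('i \<Rightarrow> rat) set" where
  "rat_vspace I = {v. finite {i. v i \<noteq> 0} \<and> {i. v i \<noteq> 0} \<subseteq> I}"

definition sumset :: "nat \<Rightarrow> 'a::monoid_add set \<Rightarrow> 'a set" where
  "sumset t X = {sum_list xs | xs. length xs = t \<and> set xs \<subseteq> X}"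

end

theory Submission
  imports Defs "HOL-Library.Nat_Bijection"
begin

text \<open>
  Let \<open>\<Lambda>\<close> be the finite set of compositions of \<open>t\<close>, and apply the Hales--Jewett theorem to words over \<open>\<Lambda>\<close>.
  A word \<open>\<mu>\<^sub>0 \<dots> \<mu>\<^sub>n\<^sub>-\<^sub>1\<close> gives vectors of \<open>\<rat>\<^sup>I\<close>: in block \<open>b\<close> put the parts of \<open>\<mu>\<^sub>b\<close>, in order,
  on increasing basis elements of a sequence \<open>h\<^sub>b\<close>. A polarized form of the Erdos--Rado theorem, with
  the blocks taken from rapidly increasing beth levels, provides sequences \<open>h\<^sub>b\<close> for which the colour of
  such a vector depends only on the word. Along a monochromatic line, let \<open>x\<^sub>i\<close> have a single
  coefficient \<open>1\<close> at \<open>h\<^sub>b i\<close> in each active block \<open>b\<close>, and \<open>1/t\<close> times a fixed copy of \<open>\<mu>\<close> in each block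
  with constant letter \<open>\<mu>\<close>. In \<open>x\<^bsub>i1\<^esub> + \<dots> + x\<^bsub>it\<^esub>\<close> the multiplicities of the distinct indices form a
  composition of \<open>t\<close>, which appears in every active block; so the sum belongs to a word of the line.
\<close>

section \<open>The Hales--Jewett theorem\<close>

text \<open>\<open>None\<close> is the wildcard of a variable word; all its occurrences receive the
  same letter.\<close>

definition inst :: "'b option list \<Rightarrow> 'b \<Rightarrow> 'b list" where
  "inst L a = map (case_option a id) L"

text \<open>Parametrizes a combinatorial subspace: each block is a line of its own, and each letter
  of the short word picks a point on one of them.\<close>

fun fill :: "'b option list list \<Rightarrow> 'b list \<Rightarrow> 'b list" where
  "fill (L # Ls) (a # u) = inst L a @ fill Ls u"
| "fill _ _ = []"

definition words :: "nat \<Rightarrow> 'b set \<Rightarrow> 'b list set" where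
  "words n \<Lambda> = {w. length w = n \<and> set w \<subseteq> \<Lambda>}"

definition lines :: "nat \<Rightarrow> 'b set \<Rightarrow> 'b option list set" where
  "lines n \<Lambda> = {L. length L = n \<and> set L \<subseteq> insert None (Some ` \<Lambda>) \<and> None \<in> set L}"

lemma finite_words: "finite \<Lambda> \<Longrightarrow> finite (words n \<Lambda>)"
  using finite_lists_length_eq[of \<Lambda> n] by (simp add: words_def conj_commute)

lemma inst_words: "L \<in> lines n \<Lambda> \<Longrightarrow> a \<in> \<Lambda> \<Longrightarrow> inst L a \<in> words n \<Lambda>"
  by (auto simp: inst_def lines_def words_def split: option.splits)

lemma words_append: "u \<in> words m \<Lambda> \<Longrightarrow> v \<in> words n \<Lambda> \<Longrightarrow> u @ v \<in> words (m + n) \<Lambda>"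
  by (auto simp: words_def)

lemma words_Suc_iff: "u \<in> words (Suc n) \<Lambda> \<longleftrightarrow> (\<exists>a v. u = a # v \<and> a \<in> \<Lambda> \<and> v \<in> words n \<Lambda>)"
  by (cases u) (auto simp: words_def)

text \<open>Packs a bounded function on a finite set into one bounded number, so that a word can be
  coloured by all the colours it produces in a family of contexts.\<close>

lemma funspace_code:
  assumes "finite S"
  obtains enc :: "('s \<Rightarrow> nat) \<Rightarrow> nat" and m
  where "\<And>g. \<forall>s\<in>S. g s < k \<Longrightarrow> enc g < m"
    and "\<And>g g' s. \<lbrakk>\<forall>s\<in>S. g s < k; \<forall>s\<in>S. g' s < k; enc g = enc g'; s \<in> S\<rbrakk> \<Longrightarrow> g s = g' s"
proof -
  let ?P = "PiE S (\<lambda>_. {..<k})"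
  have "finite ?P" using assms by (intro finite_PiE) auto
  then obtain f where f: "bij_betw f ?P {0..<card ?P}"
    using ex_bij_betw_finite_nat by blast
  show thesis
  proof (rule that)
    fix g assume "\<forall>s\<in>S. g s < k"
    then have "restrict g S \<in> ?P" by auto
    then show "f (restrict g S) < card ?P" using f by (force simp: bij_betw_def)
  next
    fix g g' s
    assume *: "\<forall>s\<in>S. g s < k" "\<forall>s\<in>S. g' s < k" "f (restrict g S) = f (restrict g' S)" "s \<in> S"
    then have "restrict g S \<in> ?P" "restrict g' S \<in> ?P" by auto
    then have "restrict g S = restrict g' S"
      using *(3) f by (auto simp: bij_betw_def inj_on_def)
    then show "g s = g' s" using *(4) by (metis restrict_apply')
  qed
qed

lemma fill_lines_words:
  assumes "list_all2 (\<lambda>L n. L \<in> lines n \<Lambda>) Ls ns" "u \<in> words (length Ls) \<Lambda>"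
  shows "fill Ls u \<in> words (sum_list ns) \<Lambda>"
  using assms
proof (induction arbitrary: u rule: list_all2_induct)
  case Nil
  then show ?case by (auto simp: words_def)
next
  case (Cons L Ls n ns)
  then show ?case by (auto simp: words_Suc_iff intro!: words_append inst_words)
qed

text \<open>Shelah's insensitivity step: on each block, two of the words \<open>f\<^sup>j e\<^sup>N\<^sup>-\<^sup>j\<close> are indistinguishable in every context,
  and they span a line.\<close>

lemma shelah_blocks:
  assumes fin: "finite \<Lambda>" and ef: "e \<in> \<Lambda>" "f \<in> \<Lambda>"
  shows "\<exists>ns. length ns = n \<and> (\<forall>c :: 'b list \<Rightarrow> nat. (\<forall>w \<in> words (sum_list ns) \<Lambda>. c w < k) \<longrightarrow>
    (\<exists>Ls. list_all2 (\<lambda>L n. L \<in> lines n \<Lambda>) Ls ns \<and>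
      (\<forall>u \<in> words n \<Lambda>. c (fill Ls u) = c (fill Ls (map (\<lambda>a. if a = f then e else a) u)))))"
proof (induction n arbitrary: k)
  case 0
  then show ?case by (auto simp: words_def)
next
  case (Suc n)
  \<comment> \<open>\<open>enc\<close> codes how the colour varies with the letter of the first
    block; such codes are the colours for the remaining blocks.\<close>
  obtain enc :: "('b \<Rightarrow> nat) \<Rightarrow> nat" and k' where enc:
    "\<And>g. \<forall>s\<in>\<Lambda>. g s < k \<Longrightarrow> enc g < k'"
    "\<And>g g' s. \<lbrakk>\<forall>s\<in>\<Lambda>. g s < k; \<forall>s\<in>\<Lambda>. g' s < k; enc g = enc g'; s \<in> \<Lambda>\<rbrakk> \<Longrightarrow> g s = g' s"
    by (rule funspace_code[OF fin, of k]) (rule that, assumption, assumption)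
  obtain ns where lns: "length ns = n" and ns: "\<And>c :: 'b list \<Rightarrow> nat. (\<forall>w \<in> words (sum_list ns) \<Lambda>. c w < k') \<Longrightarrow>
    (\<exists>Ls. list_all2 (\<lambda>L n. L \<in> lines n \<Lambda>) Ls ns \<and>
      (\<forall>u \<in> words n \<Lambda>. c (fill Ls u) = c (fill Ls (map (\<lambda>a. if a = f then e else a) u))))"
    using Suc.IH[of k'] by blast
  let ?M = "sum_list ns"
  \<comment> \<open>The first block is fixed after the others: its length \<open>N\<close> bounds
    the codes of colour patterns over all words in those blocks.\<close>
  obtain enc2 :: "('b list \<Rightarrow> nat) \<Rightarrow> nat" and N where enc2:
    "\<And>g. \<forall>s\<in>words ?M \<Lambda>. g s < k \<Longrightarrow> enc2 g < N"
    "\<And>g g' s. \<lbrakk>\<forall>s\<in>words ?M \<Lambda>. g s < k; \<forall>s\<in>words ?M \<Lambda>. g' s < k; enc2 g = enc2 g'; s \<in> words ?M \<Lambda>\<rbrakk>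
      \<Longrightarrow> g s = g' s"
    by (rule funspace_code[OF finite_words[OF fin], of ?M k]) (rule that, assumption, assumption)
  have "\<exists>Ls. list_all2 (\<lambda>L n. L \<in> lines n \<Lambda>) Ls (N # ns) \<and>
      (\<forall>u \<in> words (Suc n) \<Lambda>. c (fill Ls u) = c (fill Ls (map (\<lambda>a. if a = f then e else a) u)))"
    if c: "\<forall>w \<in> words (N + ?M) \<Lambda>. c w < k" for c :: "'b list \<Rightarrow> nat"
  proof -
    define G where "G j = replicate j f @ replicate (N - j) e" for j
    have G: "G j \<in> words N \<Lambda>" if "j \<le> N" for j
      using that ef by (auto simp: G_def words_def)
    have Gk: "\<forall>w \<in> words ?M \<Lambda>. c (G j @ w) < k" if "j \<le> N" for j
      using c words_append[OF G[OF that]] by blast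
    \<comment> \<open>There are \<open>N + 1\<close> words \<open>G 0\<close>, ...,
      \<open>G N\<close> and only \<open>N\<close> possible codes.\<close>
    have "\<not> inj_on (\<lambda>j. enc2 (\<lambda>w. c (G j @ w))) {..N}"
    proof (rule pigeonhole)
      have "(\<lambda>j. enc2 (\<lambda>w. c (G j @ w))) ` {..N} \<subseteq> {..<N}"
        using enc2(1) Gk by auto
      then have "card ((\<lambda>j. enc2 (\<lambda>w. c (G j @ w))) ` {..N}) \<le> card {..<N}"
        by (intro card_mono) auto
      then show "card ((\<lambda>j. enc2 (\<lambda>w. c (G j @ w))) ` {..N}) < card {..N}" by simp
    qed
    then obtain j l where jl: "j < l" "l \<le> N" "enc2 (\<lambda>w. c (G j @ w)) = enc2 (\<lambda>w. c (G l @ w))"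
      unfolding inj_on_def by (metis atMost_iff linorder_neqE_nat)
    have eq: "c (G j @ w) = c (G l @ w)" if "w \<in> words ?M \<Lambda>" for w
      using enc2(2)[OF Gk Gk jl(3) that] jl by simp
    \<comment> \<open>\<open>G j\<close> and \<open>G l\<close> can differ only at the positions
      from \<open>j\<close> to \<open>l - 1\<close>, which become the wildcards.\<close>
    define L where "L = map Some (replicate j f) @ replicate (l - j) None @ map Some (replicate (N - l) e)"
    have L: "L \<in> lines N \<Lambda>" using jl ef by (auto simp: L_def lines_def)
    have Le: "inst L e = G j" using jl
      by (simp add: L_def inst_def G_def replicate_add[symmetric])
    have "replicate l f = replicate j f @ replicate (l - j) f"
      using jl by (simp flip: replicate_add)
    then have Lf: "inst L f = G l"
      by (simp add: L_def inst_def G_def)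
    define c' where "c' w = enc (\<lambda>a. c (inst L a @ w))" for w
    have ck: "\<forall>a\<in>\<Lambda>. c (inst L a @ w) < k" if "w \<in> words ?M \<Lambda>" for w
      using c words_append[OF inst_words[OF L] that] by blast
    have "\<forall>w \<in> words ?M \<Lambda>. c' w < k'" using enc(1)[OF ck] by (simp add: c'_def)
    from ns[OF this] obtain Ls where Ls: "list_all2 (\<lambda>L n. L \<in> lines n \<Lambda>) Ls ns"
      "\<And>u. u \<in> words n \<Lambda> \<Longrightarrow> c' (fill Ls u) = c' (fill Ls (map (\<lambda>a. if a = f then e else a) u))"
      by blast
    have lenLs: "length Ls = n" using Ls(1) lns by (simp add: list_all2_lengthD)
    show ?thesis
    proof (intro exI conjI ballI)
      show "list_all2 (\<lambda>L n. L \<in> lines n \<Lambda>) (L # Ls) (N # ns)" using L Ls by simp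
      fix u assume "u \<in> words (Suc n) \<Lambda>"
      then obtain a v where u: "u = a # v" "a \<in> \<Lambda>" "v \<in> words n \<Lambda>"
        by (auto simp: words_Suc_iff)
      let ?v = "map (\<lambda>a. if a = f then e else a) v"
      have v': "?v \<in> words n \<Lambda>" using u(3) ef by (auto simp: words_def)
      have w: "fill Ls v \<in> words ?M \<Lambda>" "fill Ls ?v \<in> words ?M \<Lambda>"
        using fill_lines_words[OF Ls(1)] u(3) v' lenLs by auto
      \<comment> \<open>The tail is changed first, with the letter \<open>a\<close> kept; then the
        first letter is changed.\<close>
      have "c (inst L a @ fill Ls v) = c (inst L a @ fill Ls ?v)"
        using enc(2)[OF ck[OF w(1)] ck[OF w(2)] _ u(2)] Ls(2)[OF u(3)] by (simp add: c'_def)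
      also have "\<dots> = c (inst L (if a = f then e else a) @ fill Ls ?v)"
        using eq[OF w(2)] Le Lf by simp
      finally show "c (fill (L # Ls) u) = c (fill (L # Ls) (map (\<lambda>a. if a = f then e else a) u))"
        using u by simp
    qed
  qed
  then show ?case using lns by (intro exI[of _ "N # ns"]) simp
qed

text \<open>Transports a line from the short words to the long ones, so that the embedded points
  again form a line.\<close>

fun substitute :: "'b option list list \<Rightarrow> 'b option list \<Rightarrow> 'b option list" where
  "substitute (L # Ls) (x # \<tau>) = (case x of None \<Rightarrow> L | Some a \<Rightarrow> map Some (inst L a)) @ substitute Ls \<tau>"
| "substitute _ _ = []"

lemma inst_substitute:
  "length Ls = length \<tau> \<Longrightarrow> inst (substitute Ls \<tau>) a = fill Ls (inst \<tau> a)"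
  by (induction Ls \<tau> rule: list_induct2) (auto simp: inst_def split: option.splits)

lemma substitute_lines:
  assumes "list_all2 (\<lambda>L n. L \<in> lines n \<Lambda>) Ls ns" "\<tau> \<in> lines (length Ls) \<Lambda>"
  shows "substitute Ls \<tau> \<in> lines (sum_list ns) \<Lambda>"
proof -
  have "length (substitute Ls \<tau>) = sum_list ns \<and> set (substitute Ls \<tau>) \<subseteq> insert None (Some ` \<Lambda>) \<and>
     (None \<in> set \<tau> \<longrightarrow> None \<in> set (substitute Ls \<tau>))"
    if "length \<tau> = length Ls" "set \<tau> \<subseteq> insert None (Some ` \<Lambda>)" for \<tau>
    using assms(1) that
  proof (induction arbitrary: \<tau> rule: list_all2_induct)
    case (Cons L Ls n ns)
    then obtain x \<tau>' where \<tau>: "\<tau> = x # \<tau>'" "length \<tau>' = length Ls" by (cases \<tau>) auto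
    have "L \<in> lines n \<Lambda>" by fact
    then show ?case using Cons.IH[OF \<tau>(2)] Cons.prems \<tau> inst_words[of L n \<Lambda>]
      by (auto simp: lines_def words_def split: option.splits; blast)
  qed auto
  then show ?thesis using assms(2) by (auto simp: lines_def)
qed

text \<open>Induction on the alphabet. Inside the subspace from \<open>shelah_blocks\<close> the new
  letter \<open>f\<close> cannot be told from \<open>e\<close>, so a line that is monochromatic over
  the old alphabet stays so when \<open>f\<close> is added.\<close>

lemma hales_jewett:
  assumes "finite \<Lambda>" "\<Lambda> \<noteq> {}"
  shows "\<exists>n. \<forall>c :: 'b list \<Rightarrow> nat. (\<forall>w \<in> words n \<Lambda>. c w < k) \<longrightarrow>
    (\<exists>\<tau> \<in> lines n \<Lambda>. \<exists>col. \<forall>a\<in>\<Lambda>. c (inst \<tau> a) = col)"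
  using assms
proof (induction rule: finite_ne_induct)
  case (singleton a)
  have "\<forall>b\<in>{a}. c (inst [None] b) = c [a]" for c :: "'b list \<Rightarrow> nat"
    by (simp add: inst_def)
  moreover have "[None] \<in> lines 1 {a}" by (simp add: lines_def)
  ultimately show ?case by blast
next
  case (insert f \<Lambda>)
  then obtain n where n: "\<And>c :: 'b list \<Rightarrow> nat. (\<forall>w \<in> words n \<Lambda>. c w < k) \<Longrightarrow>
    (\<exists>\<tau> \<in> lines n \<Lambda>. \<exists>col. \<forall>a\<in>\<Lambda>. c (inst \<tau> a) = col)" by blast
  obtain e where e: "e \<in> \<Lambda>" using insert by blast
  let ?\<Lambda> = "insert f \<Lambda>"
  obtain ns where lns: "length ns = n" and ns: "\<And>c :: 'b list \<Rightarrow> nat. (\<forall>w \<in> words (sum_list ns) ?\<Lambda>. c w < k) \<Longrightarrow>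
    (\<exists>Ls. list_all2 (\<lambda>L n. L \<in> lines n ?\<Lambda>) Ls ns \<and>
      (\<forall>u \<in> words n ?\<Lambda>. c (fill Ls u) = c (fill Ls (map (\<lambda>a. if a = f then e else a) u))))"
    using shelah_blocks[of ?\<Lambda> e f n k] insert(1) e by blast
  have "\<exists>\<tau> \<in> lines (sum_list ns) ?\<Lambda>. \<exists>col. \<forall>a\<in>?\<Lambda>. c (inst \<tau> a) = col"
    if c: "\<forall>w \<in> words (sum_list ns) ?\<Lambda>. c w < k" for c :: "'b list \<Rightarrow> nat"
  proof -
    from ns[OF c] obtain Ls where Ls: "list_all2 (\<lambda>L n. L \<in> lines n ?\<Lambda>) Ls ns"
      "\<And>u. u \<in> words n ?\<Lambda> \<Longrightarrow> c (fill Ls u) = c (fill Ls (map (\<lambda>a. if a = f then e else a) u))"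
      by blast
    have lenLs: "length Ls = n" using Ls(1) lns by (simp add: list_all2_lengthD)
    have sub: "words n \<Lambda> \<subseteq> words n ?\<Lambda>" by (auto simp: words_def)
    have "\<forall>w \<in> words n \<Lambda>. c (fill Ls w) < k"
      using c fill_lines_words[OF Ls(1)] lenLs sub by auto
    from n[OF this] obtain \<tau> col where \<tau>: "\<tau> \<in> lines n \<Lambda>" "\<And>a. a \<in> \<Lambda> \<Longrightarrow> c (fill Ls (inst \<tau> a)) = col"
      by blast
    have \<tau>': "\<tau> \<in> lines n ?\<Lambda>" using \<tau>(1) by (auto simp: lines_def)
    have len: "length Ls = length \<tau>" using lenLs \<tau>(1) by (simp add: lines_def)
    \<comment> \<open>The constant letters of \<tau> avoid \<open>f\<close>, so only the wildcard
      positions change.\<close>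
    have "map (\<lambda>a. if a = f then e else a) (inst \<tau> f) = inst \<tau> e"
      using \<tau>(1) insert(3) by (auto simp: inst_def lines_def split: option.splits)
    then have "c (fill Ls (inst \<tau> f)) = col"
      using Ls(2)[OF inst_words[OF \<tau>', of f]] \<tau>(2)[OF e] by simp
    then have "\<forall>a\<in>?\<Lambda>. c (inst (substitute Ls \<tau>) a) = col"
      using \<tau>(2) by (simp add: inst_substitute[OF len])
    moreover have "substitute Ls \<tau> \<in> lines (sum_list ns) ?\<Lambda>"
      using substitute_lines[OF Ls(1)] \<tau>' lenLs by simp
    ultimately show ?thesis by blast
  qed
  then show ?case by blast
qed

section \<open>Cardinal bounds\<close>

lemma infinite_Times_self_lepoll:
  assumes "infinite B" shows "B \<times> B \<lesssim> B"
  using card_of_Times_same_infinite[OF assms]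
  by (metis eqpoll_iff_card_of_ordIso eqpoll_imp_lepoll)

lemma Times_lepoll_infinite:
  assumes "infinite B" "X \<lesssim> B" "Y \<lesssim> B" shows "X \<times> Y \<lesssim> B"
  using lepoll_trans[OF times_lepoll_mono[OF assms(2,3)] infinite_Times_self_lepoll[OF assms(1)]] .

lemma UN_nat_lepoll_infinite:
  fixes X :: "nat \<Rightarrow> 'a set"
  assumes "infinite B" "\<And>n. X n \<lesssim> B" shows "(\<Union>n. X n) \<lesssim> B"
proof -
  have "\<forall>n. \<exists>g. X n \<subseteq> g ` B" using assms(2) by (simp add: lepoll_iff)
  then obtain g where g: "\<And>n. X n \<subseteq> g n ` B" by metis
  have "(\<Union>n. X n) \<subseteq> (\<lambda>(n, b). g n b) ` (UNIV \<times> B)"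
    using g by fastforce
  then have "(\<Union>n. X n) \<lesssim> (UNIV :: nat set) \<times> B" by (rule subset_image_lepoll)
  also have "\<dots> \<lesssim> B"
    using assms(1) infinite_le_lepoll by (intro Times_lepoll_infinite) auto
  finally show ?thesis .
qed

lemma lists_lepoll_infinite:
  assumes B: "infinite B" shows "lists B \<lesssim> B"
proof -
  have "{xs \<in> lists B. length xs = n} \<lesssim> B" for n
  proof (induction n)
    case 0
    have "{xs \<in> lists B. length xs = 0} = {[]}" by auto
    then show ?case using finite_lepoll_infinite[OF B, of "{[]}"] by simp
  next
    case (Suc n)
    have "{xs \<in> lists B. length xs = Suc n} \<subseteq> (\<lambda>(x, xs). x # xs) ` (B \<times> {xs \<in> lists B. length xs = n})"
      by (auto simp: length_Suc_conv image_iff)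
    then have "{xs \<in> lists B. length xs = Suc n} \<lesssim> B \<times> {xs \<in> lists B. length xs = n}"
      by (rule subset_image_lepoll)
    also have "\<dots> \<lesssim> B" using Suc B by (intro Times_lepoll_infinite) auto
    finally show ?case .
  qed
  then have "(\<Union>n. {xs \<in> lists B. length xs = n}) \<lesssim> B" by (rule UN_nat_lepoll_infinite[OF B])
  moreover have "lists B = (\<Union>n. {xs \<in> lists B. length xs = n})" by blast
  ultimately show ?thesis by simp
qed

lemma lepoll_Pow_mono: "X \<lesssim> Y \<Longrightarrow> Pow X \<lesssim> Pow Y"
  unfolding lepoll_def by (metis image_Pow_mono inj_on_image_Pow)

text \<open>An extensional function is determined by its graph.\<close>

lemma PiE_lepoll_Pow: "(X \<rightarrow>\<^sub>E Y) \<lesssim> Pow (X \<times> Y)"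
  unfolding lepoll_def
proof (intro exI conjI)
  show "inj_on (\<lambda>g. {(x, g x) |x. x \<in> X}) (X \<rightarrow>\<^sub>E Y)"
  proof (rule inj_onI)
    fix g h assume "g \<in> X \<rightarrow>\<^sub>E Y" "h \<in> X \<rightarrow>\<^sub>E Y" and eq: "{(x, g x) |x. x \<in> X} = {(x, h x) |x. x \<in> X}"
    then show "g = h"
    proof (intro PiE_ext[of g X "\<lambda>_. Y" h])
      fix x assume "x \<in> X"
      then have "(x, g x) \<in> {(x, h x) |x. x \<in> X}" using eq by blast
      then show "g x = h x" by simp
    qed
  qed
  show "(\<lambda>g. {(x, g x) |x. x \<in> X}) ` (X \<rightarrow>\<^sub>E Y) \<subseteq> Pow (X \<times> Y)" by auto
qed

section \<open>The Erdos--Rado theorem\<close>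

context wellorder begin

text \<open>In an infinite set of indices, the one with the least value lies below all later ones;
  this choice is iterated.\<close>

lemma increasing_subsequence:
  fixes k :: "nat \<Rightarrow> 'a"
  assumes "inj k"
  shows "\<exists>r :: nat \<Rightarrow> nat. (\<forall>i j. i < j \<longrightarrow> r i < r j \<and> k (r i) < k (r j))"
proof -
  have least: "\<exists>x\<in>T. infinite {j. x < j \<and> k x < k j}" if "infinite T" for T
  proof -
    obtain z where "z \<in> T" using infinite_imp_nonempty[OF \<open>infinite T\<close>] by blast
    let ?v = "LEAST v. v \<in> k ` T"
    have "?v \<in> k ` T" by (rule LeastI[of "\<lambda>v. v \<in> k ` T" "k z"]) (simp add: \<open>z \<in> T\<close>)
    then obtain x where x: "x \<in> T" "k x = ?v" by fastforce
    have "k x < k j" if "j \<in> T" "x < j" for j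
    proof -
      have "k x \<le> k j" unfolding x(2) using that by (intro Least_le[of "\<lambda>v. v \<in> k ` T"]) simp
      moreover have "k x \<noteq> k j" using injD[OF assms, of x j] that by auto
      ultimately show ?thesis by simp
    qed
    then have "T - {..x} \<subseteq> {j. x < j \<and> k x < k j}" by auto
    moreover have "infinite (T - {..x})" using \<open>infinite T\<close> by simp
    ultimately show ?thesis using x(1) finite_subset by blast
  qed
  \<comment> \<open>The invariant keeps an infinite supply of later indices with larger
    values.\<close>
  have "\<exists>r :: nat \<Rightarrow> nat. \<forall>n. infinite {j. r n < j \<and> k (r n) < k j} \<and> (r n < r (Suc n) \<and> k (r n) < k (r (Suc n)))"
  proof (rule dependent_nat_choice)
    show "\<exists>x. infinite {j. x < j \<and> k x < k j}" using least[of UNIV] by blast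
    fix x and n :: nat assume "infinite {j. x < j \<and> k x < k j}"
    from least[OF this] show "\<exists>z. infinite {j. z < j \<and> k z < k j} \<and> x < z \<and> k x < k z" by blast
  qed
  then obtain r :: "nat \<Rightarrow> nat" where r: "\<And>n. r n < r (Suc n)" "\<And>n. k (r n) < k (r (Suc n))" by blast
  have "r i < r j \<and> k (r i) < k (r j)" if "i < j" for i j
    using that by (induction rule: less_Suc_induct) (auto intro: r less_trans)
  then show ?thesis by blast
qed

text \<open>\<open>s y\<close> follows the type of \<open>y\<close>: \<open>s y b\<close> is a canonical element of \<open>A\<close> having the same colours as \<open>y\<close> over the
  earlier \<open>s y j\<close>. If each \<open>y\<close> occurred on its own branch, the colours along it would determine \<open>y\<close>,
  and \<open>A\<close> would be small.\<close>

lemma end_homogeneous: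
  fixes A :: "'b set"
  assumes f: "\<And>xs. xs \<in> lists A \<Longrightarrow> f xs \<in> K"
    and big: "\<not> A \<lesssim> (lists B \<rightarrow>\<^sub>E K) \<times> Pow B"
  obtains s y where "y \<in> A" "inj_on s B" "\<And>b. b \<in> B \<Longrightarrow> s b \<in> A"
    "\<And>js b. \<lbrakk>b \<in> B; js \<in> lists B; \<forall>j\<in>set js. j < b\<rbrakk> \<Longrightarrow> f (map s js @ [s b]) = f (map s js @ [y])"
proof -
  \<comment> \<open>By the last clause, as long as \<open>y\<close> has not been chosen, the new
    element differs from all earlier ones.\<close>
  define Q where "Q y s b x \<longleftrightarrow> x \<in> A \<and>
      (\<forall>js \<in> lists {j\<in>B. j < b}. f (map s js @ [x]) = f (map s js @ [y])) \<and>
      (\<forall>j\<in>B. j < b \<longrightarrow> (s j = x \<longleftrightarrow> s j = y))" for y s b x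
  have Qcong: "Q y s b = Q y s' b" if eq: "\<And>j. j \<in> B \<Longrightarrow> j < b \<Longrightarrow> s j = s' j" for y s s' b
  proof
    fix x
    have mapeq: "map s js = map s' js" if "js \<in> lists {j\<in>B. j < b}" for js
      using that by (auto intro: eq)
    show "Q y s b x = Q y s' b x"
      unfolding Q_def by (intro conj_cong ball_cong refl) (simp_all add: mapeq eq)
  qed
  \<comment> \<open>Recursion along the well-order. \<open>Eps\<close> depends only on the
    predicate, so equal predicates give equal choices; \<open>same\<close> rests on this.\<close>
  have "\<exists>s. \<forall>b. s b = Eps (Q y s b)" for y
  proof (rule dependent_wellorder_choice)
    fix r x and g h :: "'a \<Rightarrow> 'b" assume "\<And>z. z < x \<Longrightarrow> g z = h z"
    then have "Q y g x = Q y h x" by (intro Qcong) auto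
    then show "(r = Eps (Q y g x)) = (r = Eps (Q y h x))" by simp
  qed simp
  then obtain s where s: "\<And>y b. s y b = Eps (Q y (s y) b)" by metis
  have Q: "Q y (s y) b (s y b)" if "y \<in> A" for y b
  proof -
    have "Q y (s y) b y" using that by (simp add: Q_def)
    then show ?thesis by (subst s) (rule someI)
  qed
  have sA: "s y b \<in> A" if "y \<in> A" for y b using Q[OF that] by (simp add: Q_def)
  \<comment> \<open>The signature of \<open>y\<close>: the colours along its branch and the indices
    at which the branch reaches \<open>y\<close>. It determines the branch, by induction.\<close>
  define T where "T y = (restrict (\<lambda>js. f (map (s y) js @ [y])) (lists B), {b\<in>B. s y b = y})" for y
  have same: "s y b = s z b" if "T y = T z" "b \<in> B" for y z b
    using that(2)
  proof (induction b rule: less_induct)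
    case (less b)
    have col: "f (map (s y) js @ [y]) = f (map (s z) js @ [z])" if "js \<in> lists B" for js
    proof -
      have "fst (T y) js = fst (T z) js" using \<open>T y = T z\<close> by simp
      then show ?thesis using that by (simp add: T_def)
    qed
    have eqs: "s y j = y \<longleftrightarrow> s z j = z" if "j \<in> B" for j
    proof -
      have "j \<in> snd (T y) \<longleftrightarrow> j \<in> snd (T z)" using \<open>T y = T z\<close> by simp
      then show ?thesis using that by (simp add: T_def)
    qed
    have "Q y (s y) b = Q y (s z) b" using less.IH by (intro Qcong) auto
    also have "\<dots> = Q z (s z) b"
    proof (intro ext)
      fix x
      have "map (s y) js = map (s z) js" if "js \<in> lists {j\<in>B. j < b}" for js
        using that less.IH by auto
      then have "f (map (s z) js @ [y]) = f (map (s z) js @ [z])" if "js \<in> lists {j\<in>B. j < b}" for js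
        using that col[of js] by (metis (no_types, lifting) in_lists_conv_set mem_Collect_eq)
      moreover have "s z j = y \<longleftrightarrow> s z j = z" if "j \<in> B" "j < b" for j
        using eqs[of j] less.IH[of j] that by auto
      ultimately show "Q y (s z) b x = Q z (s z) b x"
        unfolding Q_def by (intro conj_cong ball_cong refl) simp_all
    qed
    finally show ?case using s[of y b] s[of z b] by simp
  qed
  \<comment> \<open>If every branch reached its own \<open>y\<close>, then \<open>y\<close> could be
    read off from \<open>T y\<close>, and \<open>T\<close> would embed \<open>A\<close> into the set
    excluded by \<open>big\<close>.\<close>
  have "\<exists>y\<in>A. \<forall>b\<in>B. s y b \<noteq> y"
  proof (rule ccontr)
    assume *: "\<not> ?thesis"
    have "inj_on T A"
    proof (rule inj_onI)
      fix y z assume yz: "y \<in> A" "z \<in> A" "T y = T z"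
      obtain b where b: "b \<in> B" "s y b = y" using * yz by blast
      then have "b \<in> {b\<in>B. s y b = y}" by simp
      also have "\<dots> = {b\<in>B. s z b = z}" using yz(3) by (simp add: T_def)
      finally have "s z b = z" by simp
      then show "y = z" using same[OF yz(3) b(1)] b by simp
    qed
    moreover have "T ` A \<subseteq> (lists B \<rightarrow>\<^sub>E K) \<times> Pow B"
    proof (rule image_subsetI)
      fix y assume "y \<in> A"
      then have "f (map (s y) js @ [y]) \<in> K" for js using sA by (intro f) auto
      then show "T y \<in> (lists B \<rightarrow>\<^sub>E K) \<times> Pow B" by (auto simp: T_def simp del: in_lists_conv_set)
    qed
    ultimately show False using big unfolding lepoll_def by blast
  qed
  then obtain y where y: "y \<in> A" "\<And>b. b \<in> B \<Longrightarrow> s y b \<noteq> y" by blast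
  show thesis
  proof (rule that[of y "s y"])
    \<comment> \<open>Since \<open>y\<close> is not on its branch, the last clause of
      \<open>Q\<close> separates the two entries.\<close>
    have "s y b \<noteq> s y c" if "b \<in> B" "c \<in> B" "b < c" for b c
      using Q[OF y(1), of c] y(2) that by (auto simp: Q_def)
    then show "inj_on (s y) B" unfolding inj_on_def by (metis neqE)
    fix js b assume "b \<in> B" "js \<in> lists B" "\<forall>j\<in>set js. j < b"
    then show "f (map (s y) js @ [s y b]) = f (map (s y) js @ [y])"
      using Q[OF y(1), of b] by (auto simp: Q_def)
  qed (use y sA in auto)
qed

text \<open>Along \<open>s\<close> the colour of a tuple with increasing indices does not depend on
  its last entry, so homogeneity for length \<open>p\<close> on \<open>B\<close> lifts to length
  \<open>Suc p\<close> on \<open>A\<close>.\<close>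

lemma erdos_rado_step:
  assumes f: "\<And>xs. xs \<in> lists A \<Longrightarrow> f xs \<in> K"
    and big: "\<not> A \<lesssim> (lists B \<rightarrow>\<^sub>E K) \<times> Pow B"
    and IH: "\<And>g. (\<And>js. js \<in> lists B \<Longrightarrow> g js \<in> K) \<Longrightarrow> \<exists>(h :: nat \<Rightarrow> 'a) col. range h \<subseteq> B \<and>
        (\<forall>i j. i < j \<longrightarrow> h i < h j) \<and>
        (\<forall>is. sorted_wrt (<) is \<longrightarrow> length is \<le> p \<longrightarrow> g (map h is) = col (length is))"
  shows "\<exists>(h :: nat \<Rightarrow> 'a) col. range h \<subseteq> A \<and>
        (\<forall>i j. i < j \<longrightarrow> h i < h j) \<and>
        (\<forall>is. sorted_wrt (<) is \<longrightarrow> length is \<le> Suc p \<longrightarrow> f (map h is) = col (length is))"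
proof -
  obtain s y where s: "y \<in> A" "inj_on s B" "\<And>b. b \<in> B \<Longrightarrow> s b \<in> A"
    "\<And>js b. \<lbrakk>b \<in> B; js \<in> lists B; \<forall>j\<in>set js. j < b\<rbrakk> \<Longrightarrow> f (map s js @ [s b]) = f (map s js @ [y])"
    by (rule end_homogeneous[of A f K B, OF f big]) (assumption, blast)
  have "f (map s js @ [y]) \<in> K" if "js \<in> lists B" for js
    using that s(1,3) by (intro f) auto
  then obtain h :: "nat \<Rightarrow> 'a" and col where h: "range h \<subseteq> B" "\<And>i j. i < j \<Longrightarrow> h i < h j"
    "\<And>is. sorted_wrt (<) is \<Longrightarrow> length is \<le> p \<Longrightarrow> f (map s (map h is) @ [y]) = col (length is)"
    using IH[of "\<lambda>js. f (map s js @ [y])"] by blast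
  have hB: "h i \<in> B" for i using h(1) by auto
  have injh: "inj h" unfolding inj_on_def using h(2) by (metis nat_neq_iff less_irrefl)
  \<comment> \<open>The shift by one accounts for the dropped last entry; the empty tuple is treated
    separately.\<close>
  let ?col = "\<lambda>n. case n of 0 \<Rightarrow> f [] | Suc n \<Rightarrow> col n"
  have hom: "f (map (\<lambda>i. s (h i)) is) = ?col (length is)"
    if "sorted_wrt (<) is" "length is \<le> Suc p" for "is"
  proof (cases "is" rule: rev_cases)
    case (snoc js j)
    have "f (map s (map h js) @ [s (h j)]) = f (map s (map h js) @ [y])"
      using hB h(2) that snoc by (intro s(4)) (auto simp: sorted_wrt_append)
    also have "\<dots> = col (length js)"
      using that snoc by (intro h(3)) (auto simp: sorted_wrt_append)
    finally show ?thesis using snoc by (simp add: comp_def)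
  qed simp
  \<comment> \<open>\<open>s\<close> is injective but perhaps not monotone, so a subsequence with
    increasing values is extracted.\<close>
  have "inj (\<lambda>i. s (h i))" using injh s(2) hB by (auto simp: inj_on_def)
  from increasing_subsequence[OF this]
  obtain r :: "nat \<Rightarrow> nat" where r: "\<And>i j. i < j \<Longrightarrow> r i < r j" "\<And>i j. i < j \<Longrightarrow> s (h (r i)) < s (h (r j))" by blast
  have "f (map (\<lambda>i. s (h (r i))) is) = ?col (length is)"
    if "sorted_wrt (<) is" "length is \<le> Suc p" for "is"
  proof -
    have "sorted_wrt (<) (map r is)"
      unfolding sorted_wrt_map
      by (rule sorted_wrt_mono_rel[OF _ that(1)]) (rule r(1))
    then show ?thesis using hom[of "map r is"] that(2) by (simp add: comp_def)
  qed
  moreover have "range (\<lambda>i. s (h (r i))) \<subseteq> A" using s(3) hB by auto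
  ultimately show ?thesis using r(2)
    by (intro exI[of _ "\<lambda>i. s (h (r i))"] exI[of _ ?col]) simp
qed

end

section \<open>Iterating the step along the beth levels\<close>

lemma beth_mono:
  assumes "\<And>n. A (Suc n) \<approx> Pow (A n)" "i \<le> j"
  shows "A i \<lesssim> A j"
  using assms(2)
proof (induction rule: dec_induct)
  case (step n)
  note step.IH
  also have "A n \<lesssim> Pow (A n)" by (rule lepoll_Pow_self)
  also have "Pow (A n) \<approx> A (Suc n)" using assms(1) by (rule eqpoll_sym)
  finally show ?case .
qed simp

lemma beth_infinite:
  assumes "infinite (A 0)" "\<And>n. A (Suc n) \<approx> Pow (A n)"
  shows "infinite (A n)"
  using assms(1) beth_mono[of A 0 n, OF assms(2)] unfolding infinite_le_lepoll by (auto intro: lepoll_trans)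

text \<open>Each unit of length costs two levels: the signatures fit into the power set of the lower
  level, and the upper level must be strictly larger. Colour sets as large as \<open>A m\<close> are
  allowed so that functions can serve as colours.\<close>

lemma (in wellorder) erdos_rado:
  fixes A :: "nat \<Rightarrow> 'a set"
  assumes A: "infinite (A 0)" "\<And>n. A (Suc n) \<approx> Pow (A n)"
    and K: "K \<lesssim> A m"
    and f: "\<And>xs. xs \<in> lists (A (m + 2 * p)) \<Longrightarrow> f xs \<in> K"
  shows "\<exists>(h :: nat \<Rightarrow> 'a) col. range h \<subseteq> A (m + 2 * p) \<and> (\<forall>i j. i < j \<longrightarrow> h i < h j) \<and>
        (\<forall>is. sorted_wrt (<) is \<longrightarrow> length is \<le> p \<longrightarrow> f (map h is) = col (length is))"
  using f
proof (induction p arbitrary: f)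
  case 0
  have "infinite (A m)" by (rule beth_infinite[of A, OF A])
  from infinite_countable_subset[OF this]
  obtain k :: "nat \<Rightarrow> 'a" where k: "inj k \<and> range k \<subseteq> A m" ..
  from increasing_subsequence[of k] k
  obtain r :: "nat \<Rightarrow> nat" where r: "(\<forall>i j. i < j \<longrightarrow> r i < r j \<and> k (r i) < k (r j))" by blast
  have "range (\<lambda>i. k (r i)) \<subseteq> A m" using k by auto
  then show ?case using r
    by (intro exI[of _ "\<lambda>i. k (r i)"] exI[of _ "\<lambda>_. f []"]) simp
next
  case (Suc p)
  let ?B = "A (m + 2 * p)"
  have infB: "infinite ?B" by (rule beth_infinite[of A, OF A])
  have "lists ?B \<times> K \<lesssim> ?B"
    using lepoll_trans[OF K beth_mono[of A m "m + 2 * p", OF A(2)]]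
    by (intro Times_lepoll_infinite infB lists_lepoll_infinite) auto
  then have "(lists ?B \<rightarrow>\<^sub>E K) \<lesssim> Pow ?B"
    by (rule lepoll_trans[OF PiE_lepoll_Pow lepoll_Pow_mono])
  then have small: "(lists ?B \<rightarrow>\<^sub>E K) \<times> Pow ?B \<lesssim> Pow ?B"
    using infB by (intro Times_lepoll_infinite) auto
  have "Pow ?B \<prec> A (m + 2 * Suc p)"
  proof -
    have "Pow ?B \<approx> A (Suc (m + 2 * p))" using A(2) eqpoll_sym by blast
    also have "\<dots> \<prec> Pow (A (Suc (m + 2 * p)))" by (rule lesspoll_Pow_self)
    also have "\<dots> \<approx> A (Suc (Suc (m + 2 * p)))" using A(2) eqpoll_sym by blast
    finally show ?thesis by simp
  qed
  then have big: "\<not> A (m + 2 * Suc p) \<lesssim> (lists ?B \<rightarrow>\<^sub>E K) \<times> Pow ?B"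
    using lesspoll_trans1[OF lepoll_trans[OF _ small]] lesspoll_not_refl by blast
  show ?case by (rule erdos_rado_step[OF Suc.prems big Suc.IH])
qed

text \<open>The top block is made homogeneous first, colouring its tuples by the functions they induce on all
  tuples from the lower blocks.\<close>

lemma (in wellorder) polarized_erdos_rado:
  fixes A :: "nat \<Rightarrow> 'a set" and \<chi> :: "'a list list \<Rightarrow> nat"
  assumes A: "infinite (A 0)" "\<And>n. A (Suc n) \<approx> Pow (A n)"
  shows "\<exists>h :: nat \<Rightarrow> nat \<Rightarrow> 'a. (\<forall>b<n. inj (h b) \<and> range (h b) \<subseteq> A (Suc b * Suc (2 * t))) \<and>
    (\<forall>I J. (\<forall>b<n. sorted_wrt (<) (I b) \<and> sorted_wrt (<) (J b) \<and> length (I b) = length (J b) \<and> length (J b) \<le> t) \<longrightarrow>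
      \<chi> (map (\<lambda>b. map (h b) (I b)) [0..<n]) = \<chi> (map (\<lambda>b. map (h b) (J b)) [0..<n]))"
proof (induction n arbitrary: \<chi>)
  case 0
  show ?case by simp
next
  case (Suc n)
  define m where "m = n * Suc (2 * t)"
  \<comment> \<open>The levels are not assumed nested, so \<open>U\<close> gathers all those in
    which the lower sequences can lie; its size is still at most that of \<open>A m\<close>.\<close>
  define U where "U = (\<Union>i. if i \<le> m then A i else {})"
  define Y where "Y = lists (lists U)"
  have inf: "infinite (A i)" for i by (rule beth_infinite[of A, OF A])
  have "U \<lesssim> A m"
    unfolding U_def using beth_mono[of A _ m, OF A(2)] by (intro UN_nat_lepoll_infinite inf) auto
  have "A m \<subseteq> U" unfolding U_def by force
  then have infU: "infinite U" using inf finite_subset by blast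
  have "Y \<lesssim> U"
    unfolding Y_def
    by (rule lepoll_trans[OF lists_lepoll_mono[OF lists_lepoll_infinite[OF infU]] lists_lepoll_infinite[OF infU]])
  then have "Y \<times> (UNIV :: nat set) \<lesssim> U"
    using infU infinite_le_lepoll by (intro Times_lepoll_infinite) auto
  then have "(Y \<rightarrow>\<^sub>E (UNIV :: nat set)) \<lesssim> Pow (A m)"
    by (intro lepoll_trans[OF PiE_lepoll_Pow] lepoll_Pow_mono) (rule lepoll_trans[OF _ \<open>U \<lesssim> A m\<close>])
  also have "\<dots> \<approx> A (Suc m)" using A(2) by (rule eqpoll_sym)
  finally have K: "(Y \<rightarrow>\<^sub>E (UNIV :: nat set)) \<lesssim> A (Suc m)" .
  \<comment> \<open>One level pays for the functions on \<open>Y\<close> as colours and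
    \<open>2 * t\<close> levels for the tuples of length at most \<open>t\<close>; hence the spacing
    \<open>Suc (2 * t)\<close>.\<close>
  have top: "Suc m + 2 * t = Suc n * Suc (2 * t)" by (simp add: m_def)
  define f where "f xs = restrict (\<lambda>ys. \<chi> (ys @ [xs])) Y" for xs
  have "f xs \<in> Y \<rightarrow>\<^sub>E UNIV" for xs by (auto simp: f_def)
  then obtain g :: "nat \<Rightarrow> 'a" and col where g: "range g \<subseteq> A (Suc m + 2 * t)" "\<forall>i j. i < j \<longrightarrow> g i < g j"
    and gcol: "\<forall>is. sorted_wrt (<) is \<longrightarrow> length is \<le> t \<longrightarrow> f (map g is) = col (length is)"
    using erdos_rado[of A, OF A K, of t f] by auto
  have "inj g" unfolding inj_on_def using g(2) by (metis nat_neq_iff less_irrefl)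
  \<comment> \<open>The lower blocks must be homogeneous for every length \<open>p\<close> of the
    top tuple at once; \<open>[0..<p]\<close> represents that length.\<close>
  define \<chi>' where "\<chi>' ys = list_encode (map (\<lambda>p. \<chi> (ys @ [map g [0..<p]])) [0..<Suc t])" for ys
  obtain h :: "nat \<Rightarrow> nat \<Rightarrow> 'a" where h: "\<forall>b<n. inj (h b) \<and> range (h b) \<subseteq> A (Suc b * Suc (2 * t))"
    and hom: "\<forall>I J. (\<forall>b<n. sorted_wrt (<) (I b) \<and> sorted_wrt (<) (J b) \<and> length (I b) = length (J b) \<and> length (J b) \<le> t) \<longrightarrow>
      \<chi>' (map (\<lambda>b. map (h b) (I b)) [0..<n]) = \<chi>' (map (\<lambda>b. map (h b) (J b)) [0..<n])"
    using Suc.IH[of \<chi>'] by (elim exE conjE)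
  have hU: "h b i \<in> U" if "b < n" for b i
  proof -
    have "Suc b * Suc (2 * t) \<le> m" unfolding m_def using that by (intro mult_le_mono1) simp
    moreover have "h b i \<in> A (Suc b * Suc (2 * t))" using h that by blast
    ultimately show ?thesis unfolding U_def by (intro UN_I[of "Suc b * Suc (2 * t)"]) auto
  qed
  let ?Z = "\<lambda>I. map (\<lambda>b. map (h b) (I b)) [0..<n]"
  have last: "\<chi> (?Z I @ [map g is]) = \<chi> (?Z I @ [map g [0..<length is]])"
    if "sorted_wrt (<) is" "length is \<le> t" for I "is"
  proof -
    have "?Z I \<in> Y" using hU by (auto simp: Y_def)
    moreover have "f (map g is) = f (map g [0..<length is])"
      using gcol that by simp
    then have "f (map g is) (?Z I) = f (map g [0..<length is]) (?Z I)" by simp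
    ultimately show ?thesis unfolding f_def by simp
  qed
  let ?h = "h(n := g)"
  have "\<chi> (?Z I @ [map g (I n)]) = \<chi> (?Z J @ [map g (J n)])"
    if IJ: "\<And>b. b < Suc n \<Longrightarrow> sorted_wrt (<) (I b) \<and> sorted_wrt (<) (J b) \<and> length (I b) = length (J b) \<and> length (J b) \<le> t" for I J
  proof -
    have "\<chi>' (?Z I) = \<chi>' (?Z J)" using IJ by (intro hom[rule_format]) simp
    then have eq: "\<chi> (?Z I @ [map g [0..<p]]) = \<chi> (?Z J @ [map g [0..<p]])" if "p \<le> t" for p
      using that unfolding \<chi>'_def list_encode_eq map_eq_conv by (auto simp del: upt_Suc)
    have n: "sorted_wrt (<) (I n)" "sorted_wrt (<) (J n)" "length (I n) = length (J n)" "length (J n) \<le> t"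
      using IJ[of n] by auto
    have "\<chi> (?Z I @ [map g (I n)]) = \<chi> (?Z I @ [map g [0..<length (J n)]])"
      using last[OF n(1), of I] n(3,4) by simp
    also have "\<dots> = \<chi> (?Z J @ [map g [0..<length (J n)]])" by (rule eq[OF n(4)])
    also have "\<dots> = \<chi> (?Z J @ [map g (J n)])" by (rule last[OF n(2,4), symmetric])
    finally show ?thesis .
  qed
  moreover have "map (\<lambda>b. map (?h b) (I b)) [0..<Suc n] = ?Z I @ [map g (I n)]"
    for I :: "nat \<Rightarrow> nat list" by (auto intro: map_cong)
  ultimately have "\<forall>I J. (\<forall>b<Suc n. sorted_wrt (<) (I b) \<and> sorted_wrt (<) (J b) \<and> length (I b) = length (J b) \<and> length (J b) \<le> t) \<longrightarrow>
      \<chi> (map (\<lambda>b. map (?h b) (I b)) [0..<Suc n]) = \<chi> (map (\<lambda>b. map (?h b) (J b)) [0..<Suc n])"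
    by presburger
  moreover have "\<forall>b<Suc n. inj (?h b) \<and> range (?h b) \<subseteq> A (Suc b * Suc (2 * t))"
  proof (intro allI impI)
    fix b assume "b < Suc n"
    then consider "b < n" | "b = n" by linarith
    then show "inj (?h b) \<and> range (?h b) \<subseteq> A (Suc b * Suc (2 * t))"
    proof cases
      case 1 then show ?thesis using h by simp
    next
      case 2 then show ?thesis using g(1) \<open>inj g\<close> unfolding top by simp
    qed
  qed
  ultimately show ?case by blast
qed

text \<open>The type \<open>'i\<close> carries no order; the class predicate makes the results of
  the \<open>wellorder\<close> context available for it.\<close>

lemma exists_class_wellorder:
  "\<exists>le lt :: 'i \<Rightarrow> 'i \<Rightarrow> bool. class.wellorder le lt"
proof -
  obtain r :: "('i \<times> 'i) set" where r: "well_order_on UNIV r" using well_order_on by blast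
  then have lin: "refl r" "trans r" "antisym r" "total r" and wf: "wf (r - Id)"
    by (auto simp: well_order_on_def linear_order_on_def partial_order_on_def preorder_on_def)
  have "class.wellorder (\<lambda>x y. (x, y) \<in> r) (\<lambda>x y. (x, y) \<in> r - Id)"
  proof
    fix x y z :: 'i
    show "(x, y) \<in> r - Id \<longleftrightarrow> (x, y) \<in> r \<and> (y, x) \<notin> r"
      using lin by (auto dest: antisymD reflD)
    show "(x, x) \<in> r" using lin by (auto dest: reflD)
    show "(x, y) \<in> r \<Longrightarrow> (y, z) \<in> r \<Longrightarrow> (x, z) \<in> r" using lin by (auto dest: transD)
    show "(x, y) \<in> r \<Longrightarrow> (y, x) \<in> r \<Longrightarrow> x = y" using lin by (auto dest: antisymD)
    show "(x, y) \<in> r \<or> (y, x) \<in> r"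
      using lin by (cases "x = y") (auto dest: reflD simp: total_on_def)
  next
    fix P and a :: 'i
    assume "\<And>x. (\<And>y. (y, x) \<in> r - Id \<Longrightarrow> P y) \<Longrightarrow> P x"
    then show "P a" using wf_induct_rule[OF wf] by blast
  qed
  then show ?thesis by blast
qed

section \<open>Compositions and their vectors\<close>

definition compositions :: "nat \<Rightarrow> nat list set" where
  "compositions t = {\<mu>. sum_list \<mu> = t \<and> 0 \<notin> set \<mu>}"

lemma length_composition: "\<mu> \<in> compositions t \<Longrightarrow> length \<mu> \<le> t"
proof -
  have "0 \<notin> set \<mu> \<Longrightarrow> length \<mu> \<le> sum_list \<mu>" by (induction \<mu>) auto
  then show "\<mu> \<in> compositions t \<Longrightarrow> length \<mu> \<le> t" by (auto simp: compositions_def)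
qed

lemma finite_compositions: "finite (compositions t)"
proof (rule finite_subset)
  show "compositions t \<subseteq> {\<mu>. set \<mu> \<subseteq> {..t} \<and> length \<mu> \<le> t}"
    using length_composition member_le_sum_list by (fastforce simp: compositions_def)
qed (simp add: finite_lists_length_le)

text \<open>This composition is the letter that a sum of vectors with indices \<open>xs\<close>
  shows in an active block.\<close>

lemma count_list_composition:
  "map (count_list xs) (sorted_list_of_set (set xs)) \<in> compositions (length xs)"
proof -
  have "sum_list (map (count_list xs) (sorted_list_of_set (set xs))) = sum (count_list xs) (set xs)"
    by (subst sum_list_distinct_conv_sum_set) auto
  then show ?thesis by (auto simp: compositions_def sum_count_set count_list_0_iff)
qed

lemma sum_list_apply: "(\<Sum>f\<leftarrow>fs. f :: 'i \<Rightarrow> rat) v = (\<Sum>f\<leftarrow>fs. f v)"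
  by (induction fs) auto

lemma sum_list_eq_sum_count:
  fixes g :: "'b \<Rightarrow> rat"
  shows "(\<Sum>x\<leftarrow>xs. g x) = (\<Sum>x\<in>set xs. of_nat (count_list xs x) * g x)"
proof (induction xs)
  case (Cons a xs)
  have "(\<Sum>x\<in>set (a # xs). of_nat (count_list (a # xs) x) * g x) =
      (\<Sum>x\<in>insert a (set xs). (if x = a then g x else 0) + of_nat (count_list xs x) * g x)"
    by (intro sum.cong) (auto simp: algebra_simps)
  also have "\<dots> = g a + (\<Sum>x\<in>insert a (set xs). of_nat (count_list xs x) * g x)"
    by (simp add: sum.distrib)
  also have "(\<Sum>x\<in>insert a (set xs). of_nat (count_list xs x) * g x) = (\<Sum>x\<in>set xs. of_nat (count_list xs x) * g x)"
    by (intro sum.mono_neutral_right) auto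
  finally show ?case using Cons by simp
qed simp

lemma sum_list_sum_swap:
  "(\<Sum>x\<leftarrow>xs. \<Sum>b\<in>B. g b x :: rat) = (\<Sum>b\<in>B. \<Sum>x\<leftarrow>xs. g b x)"
  by (induction xs) (simp_all add: sum.distrib)

definition weighted :: "nat list \<Rightarrow> 'i list \<Rightarrow> 'i \<Rightarrow> rat" where
  "weighted \<mu> xs v = (\<Sum>(m, x)\<leftarrow>zip \<mu> xs. if x = v then of_nat m else 0)"

text \<open>The blocks are added as vectors, which makes sense even when their supports
  overlap.\<close>

definition combine :: "nat list list \<Rightarrow> 'i list list \<Rightarrow> 'i \<Rightarrow> rat" where
  "combine w xss v = (\<Sum>b<length w. weighted (w ! b) (xss ! b) v)"

lemma weighted_nonneg: "weighted \<mu> xs v \<ge> 0"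
  unfolding weighted_def by (intro sum_list_nonneg) auto

lemma weighted_eq_0: "v \<notin> set xs \<Longrightarrow> weighted \<mu> xs v = 0"
proof -
  assume "v \<notin> set xs"
  then have "\<forall>(m, x)\<in>set (zip \<mu> xs). x \<noteq> v" by (auto dest: set_zip_rightD)
  then have "weighted \<mu> xs v = (\<Sum>_\<leftarrow>zip \<mu> xs. 0)"
    unfolding weighted_def by (intro arg_cong[of _ _ sum_list] map_cong) auto
  then show ?thesis by simp
qed

lemma rat_vspaceI:
  assumes "finite F" "F \<subseteq> I" "\<And>v. v \<notin> F \<Longrightarrow> x v = 0"
  shows "x \<in> rat_vspace I"
proof -
  have "{i. x i \<noteq> 0} \<subseteq> F" using assms(3) by blast
  then show ?thesis using assms(1,2) finite_subset by (auto simp: rat_vspace_def)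
qed

lemma combine_rat_vspace:
  assumes "\<And>b. b < length w \<Longrightarrow> set (xss ! b) \<subseteq> I"
  shows "combine w xss \<in> rat_vspace I"
proof (rule rat_vspaceI[of "\<Union>b<length w. set (xss ! b)"])
  fix v assume "v \<notin> (\<Union>b<length w. set (xss ! b))"
  then show "combine w xss v = 0" by (simp add: combine_def weighted_eq_0)
qed (use assms in auto)

text \<open>Grouping equal indices turns multiplicities into coefficients.\<close>

lemma sum_list_indicator_weighted:
  "(\<Sum>i\<leftarrow>is. if g i = v then 1 else 0) =
    weighted (map (count_list is) (sorted_list_of_set (set is))) (map g (sorted_list_of_set (set is))) v"
proof -
  let ?ds = "sorted_list_of_set (set is)"
  have "zip (map (count_list is) ?ds) (map g ?ds) = map (\<lambda>d. (count_list is d, g d)) ?ds"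
    by (simp add: zip_map_map zip_same_conv_map comp_def)
  then have "weighted (map (count_list is) ?ds) (map g ?ds) v =
      (\<Sum>d\<leftarrow>?ds. if g d = v then of_nat (count_list is d) else 0)"
    by (simp add: weighted_def comp_def)
  also have "\<dots> = (\<Sum>d\<in>set is. of_nat (count_list is d) * (if g d = v then 1 else 0))"
    by (subst sum_list_distinct_conv_sum_set) (auto intro: sum.cong)
  finally show ?thesis by (subst sum_list_eq_sum_count) simp
qed

section \<open>Construction of the infinite set with monochromatic sumset\<close>

theorem theorem4:
  fixes I :: "'i set" and k t :: nat and c :: "('i \<Rightarrow> rat) \<Rightarrow> nat"
  assumes "has_card_beth_omega I"
    and "k > 0" and "t > 0"
    and "\<forall>v\<in>rat_vspace I. c v < k"
  shows "\<exists>X. X \<subseteq> rat_vspace I \<and> infinite X \<and>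
           (\<exists>col. \<forall>y\<in>sumset t X. c y = col)"
proof -
  obtain A :: "nat \<Rightarrow> 'i set" where A0: "A 0 \<approx> (UNIV :: nat set)"
    and A: "\<And>n. A (Suc n) \<approx> Pow (A n)" and I: "I = (\<Union>n. A n)"
    using assms(1) unfolding has_card_beth_omega_def by blast
  have infA: "infinite (A 0)" using eqpoll_finite_iff[OF A0] by simp
  let ?\<Lambda> = "compositions t"
  have "[t] \<in> ?\<Lambda>" using assms(3) by (simp add: compositions_def)
  then have "?\<Lambda> \<noteq> {}" by blast
  then obtain n where hj: "\<And>C :: nat list list \<Rightarrow> nat. (\<forall>w \<in> words n ?\<Lambda>. C w < k) \<Longrightarrow>
      \<exists>\<tau> \<in> lines n ?\<Lambda>. \<exists>col. \<forall>\<mu>\<in>?\<Lambda>. C (inst \<tau> \<mu>) = col"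
    using hales_jewett[OF finite_compositions] by metis
  obtain ws where ws: "set ws = words n ?\<Lambda>"
    using finite_list[OF finite_words[OF finite_compositions]] by blast
  \<comment> \<open>One choice of sequences must serve all words, so the colours for the whole list
    \<open>ws\<close> are packed into one number.\<close>
  define \<chi> where "\<chi> xss = list_encode (map (\<lambda>w. c (combine w xss)) ws)" for xss
  obtain le lt :: "'i \<Rightarrow> 'i \<Rightarrow> bool" where wo: "class.wellorder le lt"
    using exists_class_wellorder by blast
  obtain h :: "nat \<Rightarrow> nat \<Rightarrow> 'i" where h: "\<forall>b<n. inj (h b) \<and> range (h b) \<subseteq> A (Suc b * Suc (2 * t))"
    and hom: "\<forall>I J. (\<forall>b<n. sorted_wrt (<) (I b) \<and> sorted_wrt (<) (J b) \<and> length (I b) = length (J b) \<and> length (J b) \<le> t) \<longrightarrow>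
      \<chi> (map (\<lambda>b. map (h b) (I b)) [0..<n]) = \<chi> (map (\<lambda>b. map (h b) (J b)) [0..<n])"
    using wellorder.polarized_erdos_rado[OF wo, of A n t \<chi>, OF infA A] by (elim exE conjE)
  have hI: "h b i \<in> I" if "b < n" for b i using h that I by blast
  \<comment> \<open>The standard copy of a word, on initial segments of the sequences; its colour is
    the one given to the word in Hales--Jewett.\<close>
  define std where "std w = map (\<lambda>b. map (h b) [0..<length (w ! b)]) [0..<n]" for w :: "nat list list"
  have "c (combine w (std w)) < k" if "w \<in> words n ?\<Lambda>" for w
  proof -
    have "combine w (std w) \<in> rat_vspace I"
      using that hI by (intro combine_rat_vspace) (auto simp: words_def std_def)
    then show ?thesis using assms(4) by blast
  qed
  then obtain \<tau> col where \<tau>: "\<tau> \<in> lines n ?\<Lambda>"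
    and col: "\<And>\<mu>. \<mu> \<in> ?\<Lambda> \<Longrightarrow> c (combine (inst \<tau> \<mu>) (std (inst \<tau> \<mu>))) = col"
    using hj[of "\<lambda>w. c (combine w (std w))"] by blast
  have len: "length \<tau> = n" using \<tau> by (simp add: lines_def)
  \<comment> \<open>The part of \<open>x i\<close> from block \<open>b\<close>; division by
    \<open>t\<close> makes \<open>t\<close> summands restore a constant block exactly.\<close>
  define G where "G b i v = (case \<tau> ! b of None \<Rightarrow> if h b i = v then 1 else 0
      | Some \<mu> \<Rightarrow> weighted \<mu> (map (h b) [0..<length \<mu>]) v / of_nat t)" for b i v
  define x where "x i v = (\<Sum>b<n. G b i v)" for i v
  \<comment> \<open>Ranges of different \<open>h b\<close> may overlap; nonnegativity rules out
    cancellation there.\<close>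
  have G_nonneg: "G b i v \<ge> 0" for b i v
    using weighted_nonneg by (auto simp: G_def split: option.split intro!: divide_nonneg_nonneg)
  have x_in: "x i \<in> rat_vspace I" for i
  proof (rule rat_vspaceI[of "\<Union>b<n. insert (h b i) (case \<tau> ! b of None \<Rightarrow> {} | Some \<mu> \<Rightarrow> h b ` {0..<length \<mu>})"])
    fix v assume "v \<notin> (\<Union>b<n. insert (h b i) (case \<tau> ! b of None \<Rightarrow> {} | Some \<mu> \<Rightarrow> h b ` {0..<length \<mu>}))"
    then have "G b i v = 0" if "b < n" for b
      using that by (auto simp: G_def split: option.splits intro!: weighted_eq_0)
    then show "x i v = 0" by (simp add: x_def)
  qed (use hI in \<open>auto split: option.splits\<close>)
  \<comment> \<open>The argument goes through supports instead of injectivity of \<open>x\<close>: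
    in an active block they cover the infinite range of \<open>h b\<close>.\<close>
  have "infinite (range x)"
  proof
    assume "finite (range x)"
    then have fin: "finite (\<Union>y\<in>range x. {v. y v \<noteq> 0})"
      using x_in by (intro finite_UN_I) (auto simp: rat_vspace_def)
    have "None \<in> set \<tau>" using \<tau> by (simp add: lines_def)
    then obtain b where b: "b < n" "\<tau> ! b = None" using len by (auto simp: in_set_conv_nth)
    have "x i (h b i) \<noteq> 0" for i
    proof -
      have "G b i (h b i) \<le> x i (h b i)"
        unfolding x_def using b(1) G_nonneg by (intro member_le_sum) auto
      moreover have "G b i (h b i) = 1" by (simp add: G_def b(2))
      ultimately show ?thesis by auto
    qed
    then have "range (h b) \<subseteq> (\<Union>y\<in>range x. {v. y v \<noteq> 0})" by blast
    then show False using fin finite_subset range_inj_infinite[of "h b"] h b(1) by blast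
  qed
  moreover have "c y = col" if y: "y \<in> sumset t (range x)" for y
  proof -
    obtain xs where xs: "y = sum_list xs" "length xs = t" "set xs \<subseteq> range x"
      using y unfolding sumset_def by blast
    then have "xs \<in> lists (range x)" by (simp add: lists_eq_set)
    then obtain "is" where "is": "xs = map x is" by (auto simp: lists_image)
    have len_is: "length is = t" using xs "is" by simp
    \<comment> \<open>The multiplicities of the distinct indices, in increasing order, form the
      letter \<mu> for the wildcard. It varies with \<open>y\<close>, but the whole line has one
      colour.\<close>
    define ds where "ds = sorted_list_of_set (set is)"
    define \<mu> where "\<mu> = map (count_list is) ds"
    have \<mu>: "\<mu> \<in> ?\<Lambda>" unfolding \<mu>_def ds_def len_is[symmetric] by (rule count_list_composition)
    let ?w = "inst \<tau> \<mu>"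
    have w: "?w \<in> words n ?\<Lambda>" using inst_words[OF \<tau> \<mu>] .
    have len_w: "length ?w = n" using w by (simp add: words_def)
    \<comment> \<open>The positions occupied by the sum in block \<open>b\<close>: the actual
      indices if it is active, the fixed initial segment otherwise.\<close>
    define J where "J b = (case \<tau> ! b of None \<Rightarrow> ds | Some \<nu> \<Rightarrow> [0..<length \<nu>])" for b
    have wb: "?w ! b = (case \<tau> ! b of None \<Rightarrow> \<mu> | Some \<nu> \<Rightarrow> \<nu>)" if "b < n" for b
      using that len by (auto simp: inst_def split: option.splits)
    have "y = combine ?w (map (\<lambda>b. map (h b) (J b)) [0..<n])"
    proof
      fix v
      have "y v = (\<Sum>i\<leftarrow>is. \<Sum>b<n. G b i v)"
        using sum_list_apply[of "map x is" v] by (simp add: xs(1) "is" x_def comp_def)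
      also have "\<dots> = (\<Sum>b<n. \<Sum>i\<leftarrow>is. G b i v)" by (rule sum_list_sum_swap)
      also have "\<dots> = (\<Sum>b<n. weighted (?w ! b) (map (h b) (J b)) v)"
      proof (intro sum.cong refl)
        fix b assume "b \<in> {..<n}"
        then show "(\<Sum>i\<leftarrow>is. G b i v) = weighted (?w ! b) (map (h b) (J b)) v"
          using assms(3) len_is
          by (cases "\<tau> ! b")
            (simp_all add: G_def J_def wb[unfolded \<mu>_def ds_def] \<mu>_def ds_def sum_list_indicator_weighted sum_list_triv)
      qed
      finally show "y v = combine ?w (map (\<lambda>b. map (h b) (J b)) [0..<n]) v"
        by (simp add: combine_def len_w)
    qed
    \<comment> \<open>In each block \<open>J b\<close> and the initial segment have the same length,
      at most \<open>t\<close>, so passing to the standard copy preserves the colour.\<close>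
    moreover have "\<chi> (map (\<lambda>b. map (h b) (J b)) [0..<n]) = \<chi> (std ?w)"
      unfolding std_def
    proof (rule hom[rule_format])
      fix b assume b: "b < n"
      then have "?w ! b \<in> ?\<Lambda>" using w by (auto simp: words_def)
      then have "length (?w ! b) \<le> t" by (rule length_composition)
      then show "sorted_wrt (<) (J b) \<and> sorted_wrt (<) [0..<length (?w ! b)] \<and>
          length (J b) = length [0..<length (?w ! b)] \<and> length [0..<length (?w ! b)] \<le> t"
        using wb[OF b] by (auto simp: J_def \<mu>_def ds_def split: option.splits)
    qed
    then have "c (combine ?w (map (\<lambda>b. map (h b) (J b)) [0..<n])) = c (combine ?w (std ?w))"
      using w ws unfolding \<chi>_def list_encode_eq map_eq_conv by blast
    ultimately show ?thesis using col[OF \<mu>] by simp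
  qed
  ultimately show ?thesis using x_in by (intro exI[of _ "range x"]) blast
qed

end
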